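(* The map $u \longmapsto (\mathsf{P}(u), \mathsf{Q}(u))$ is a bijection between the elements of $A^*$ and the set formed by the pairs $\left((T_L, T_R), (S_L, S_R)\right)$ where (i) $(T_L, T_R)$ is a pair of twin binary search trees: $T_L$ (resp. $T_R$) is a left (resp. right) binary search tree, and $T_L$ and $T_R$ have the same inorder reading; (ii) $(S_L, S_R)$ is a pair of twin binary trees where $S_L$ (resp. $S_R$) is an increasing (resp. decreasing) binary tree, and $S_L$ and $S_R$ have the same inorder reading; (iii) $(T_L, T_R)$ and $(S_L, S_R)$ have the same shape.
   Context: $A = \{a_1 < a_2 < \cdots\}$ is a totally ordered infinite alphabet and $A^*$ is the free monoid of words on $A$. The standardized word $\mathrm{std}(u)$ of $u\in A^*$ is the unique permutation of size $|u|$ having the same inversions as $u$ (pairs $(i,j)$ with $i<j$ and $u_i>u_j$). A binary tree is either a leaf (empty tree) or a node with a left and a right binary subtree. The inorder traversal visits recursively the left subtree, then the root, then the right subtree; the inorder reading of a labeled tree is the word of the labels of its nodes in this order. The shape of a labeled tree (or pair of trees) is obtained by forgetting labels. The canopy of a binary tree with $n$ nodes is the word of length $n-1$ on $\{0,1\}$ obtained by reading its leaves from left to right except the first and the last one, writing $0$ if the leaf is a right child and $1$ if it is a left child. A pair of twin binary trees is a pair $(T_L,T_R)$ of binary trees with the same number $n$ of nodes whose canopies differ at every position $1 \leq i \leq n-1$; a labeled pair is called a pair of twin binary trees if its shape is. A tree with nodes labeled by $A$ is a right (resp. left) binary search tree if for every node $x$ labeled by $b$, every label $a$ in its left subtree and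 every label $c$ in its right subtree, $a \leq b < c$ (resp. $a < b \leq c$). A pair of twin binary search trees is an $A$-labeled pair of twin binary trees $(T_L,T_R)$ such that $T_L$ is a left binary search tree, $T_R$ is a right binary search tree, and both have the same inorder reading. An increasing (resp. decreasing) binary tree is a binary tree with $n$ nodes bijectively labeled on $\{1,\dots,n\}$ such that the label of each child is greater (resp. smaller) than the label of its parent. Leaf insertion of a letter $a$ into a right (resp. left) binary search tree $T$: if $T$ is empty, return the one-node tree labeled $a$; otherwise, with $b$ the label of the root, if $a \leq b$ (resp. $a<b$) recursively leaf insert $a$ into the left subtree, otherwise into the right subtree. The Baxter $\mathsf{P}$-symbol of $u$ is $\mathsf{P}(u) = (T_L,T_R)$ where $T_L$ (resp. $T_R$) is the left (resp. right) binary search tree obtained by leaf inserting the letters of $u$ from left to right (resp. right to left), starting from the empty tree. For a word $u$, $\mathrm{incr}(u)$ is the empty tree if $u$ is empty, and otherwise is the tree with root labeled $a$, left subtree $\mathrm{incr}(v)$ and right subtree $\mathrm{incr}(w)$, where $u = v a w$, $a = \min(u)$ and $a < \min(v)$ (leftmost minimal letter). Likewise $\mathrm{decr}(u)$ is empty if $u$ is empty, and otherwise has root labeled $b$, left subtree $\mathrm{decr}(v)$ and right subtree $\mathrm{decr}(w)$, where $u = v b w$, $b = \max(u)$ and $b > \max(w)$ (rightmost maximal letter). The Baxter $\mathsf{Q}$-symbol of $u$ is $\mathsf{Q}(u) = (S_L,S_R)$ with $S_L = \mathrm{incr}(\mathrm{std}(u)^{-1})$ and $S_R = \mathrm{decr}(\mathrm{std}(u)^{-1})$.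 *)

theory Defs
  imports "HOL-Library.Tree" "HOL-Combinatorics.Permutations"
begin

definition shape :: "'a tree \<Rightarrow> unit tree" where
  "shape t = map_tree (\<lambda>_. ()) t"

text \<open>
  The leaves of a tree from left to right, each recorded as 0 if it is a right child and 1 if it
  is a left child. The first argument is the value recorded for a leaf without parent, i.e. for the
  empty tree; the canopy does not depend on it.
\<close>

fun leaf_sides :: "nat \<Rightarrow> 'a tree \<Rightarrow> nat list" where
  "leaf_sides d \<langle>\<rangle> = [d]"
| "leaf_sides d \<langle>l, _, r\<rangle> = leaf_sides 1 l @ leaf_sides 0 r"

definition canopy :: "'a tree \<Rightarrow> nat list" where
  "canopy t = butlast (tl (leaf_sides 0 t))"

lemma length_leaf_sides: "length (leaf_sides d t) = Suc (size t)"
  by (induction d t rule: leaf_sides.induct) simp_all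

lemma length_canopy: "length (canopy t) = size t - 1"
  by (simp add: canopy_def length_leaf_sides)

definition twin_binary_trees :: "'a tree \<times> 'a tree \<Rightarrow> bool" where
  "twin_binary_trees = (\<lambda>(tL, tR). size tL = size tR \<and>
     (\<forall>i < size tL - 1. canopy tL ! i \<noteq> canopy tR ! i))"

fun right_bst :: "'a::linorder tree \<Rightarrow> bool" where
  "right_bst \<langle>\<rangle> \<longleftrightarrow> True"
| "right_bst \<langle>l, b, r\<rangle> \<longleftrightarrow>
     (\<forall>a\<in>set_tree l. a \<le> b) \<and> (\<forall>c\<in>set_tree r. b < c) \<and> right_bst l \<and> right_bst r"

fun left_bst :: "'a::linorder tree \<Rightarrow> bool" where
  "left_bst \<langle>\<rangle> \<longleftrightarrow> True"
| "left_bst \<langle>l, b, r\<rangle> \<longleftrightarrow>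
     (\<forall>a\<in>set_tree l. a < b) \<and> (\<forall>c\<in>set_tree r. b \<le> c) \<and> left_bst l \<and> left_bst r"

definition twin_bsts :: "'a::linorder tree \<times> 'a tree \<Rightarrow> bool" where
  "twin_bsts = (\<lambda>(tL, tR). twin_binary_trees (tL, tR) \<and> left_bst tL \<and> right_bst tR \<and>
     inorder tL = inorder tR)"

text \<open>Every parent label stands in relation \<open>R\<close> to the labels of its (at most two) children.\<close>

fun parent_child :: "('a \<Rightarrow> 'a \<Rightarrow> bool) \<Rightarrow> 'a tree \<Rightarrow> bool" where
  "parent_child R \<langle>\<rangle> \<longleftrightarrow> True"
| "parent_child R \<langle>l, a, r\<rangle> \<longleftrightarrow>
     (case l of \<langle>\<rangle> \<Rightarrow> True | \<langle>_, b, _\<rangle> \<Rightarrow> R a b) \<and>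
     (case r of \<langle>\<rangle> \<Rightarrow> True | \<langle>_, c, _\<rangle> \<Rightarrow> R a c) \<and>
     parent_child R l \<and> parent_child R r"

definition bijectively_labeled :: "nat tree \<Rightarrow> bool" where
  "bijectively_labeled t \<longleftrightarrow> distinct (inorder t) \<and> set_tree t = {1..size t}"

definition increasing_tree :: "nat tree \<Rightarrow> bool" where
  "increasing_tree t \<longleftrightarrow> bijectively_labeled t \<and> parent_child (\<lambda>p c. c > p) t"

definition decreasing_tree :: "nat tree \<Rightarrow> bool" where
  "decreasing_tree t \<longleftrightarrow> bijectively_labeled t \<and> parent_child (\<lambda>p c. c < p) t"

fun right_insert :: "'a::linorder \<Rightarrow> 'a tree \<Rightarrow> 'a tree" where
  "right_insert a \<langle>\<rangle> = \<langle>\<langle>\<rangle>, a, \<langle>\<rangle>\<rangle>"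
| "right_insert a \<langle>l, b, r\<rangle> =
     (if a \<le> b then \<langle>right_insert a l, b, r\<rangle> else \<langle>l, b, right_insert a r\<rangle>)"

fun left_insert :: "'a::linorder \<Rightarrow> 'a tree \<Rightarrow> 'a tree" where
  "left_insert a \<langle>\<rangle> = \<langle>\<langle>\<rangle>, a, \<langle>\<rangle>\<rangle>"
| "left_insert a \<langle>l, b, r\<rangle> =
     (if a < b then \<langle>left_insert a l, b, r\<rangle> else \<langle>l, b, left_insert a r\<rangle>)"

text \<open>
  Here \<open>fold\<close> inserts the letters of \<open>u\<close> from left to right, and \<open>foldr\<close> from right to left.
\<close>

definition P_symbol :: "'a::linorder list \<Rightarrow> 'a tree \<times> 'a tree" where
  "P_symbol u = (fold left_insert u \<langle>\<rangle>, foldr right_insert u \<langle>\<rangle>)"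

text \<open>
  Positions in words are numbered from 1 here, so that the permutation of size \<open>n\<close> acts on
  \<open>{1..n}\<close>.
\<close>

definition inversions :: "'a::linorder list \<Rightarrow> (nat \<times> nat) set" where
  "inversions u = {(i, j). 1 \<le> i \<and> i < j \<and> j \<le> length u \<and> u ! (i - 1) > u ! (j - 1)}"

definition perm_word :: "nat \<Rightarrow> (nat \<Rightarrow> nat) \<Rightarrow> nat list" where
  "perm_word n p = map p [1..<Suc n]"

definition std :: "'a::linorder list \<Rightarrow> nat \<Rightarrow> nat" where
  "std u = (THE p. p permutes {1..length u} \<and>
     inversions (perm_word (length u) p) = inversions u)"

lemma inversions_perm_word:
  "inversions (perm_word n p) = {(i, j). 1 \<le> i \<and> i < j \<and> j \<le> n \<and> p i > p j}"
  by (auto simp: inversions_def perm_word_def simp del: upt_Suc)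

lemma permutes_rank:
  assumes p: "p permutes {1..n::nat}" and i: "i \<in> {1..n}"
  shows "p i = card {j \<in> {1..n}. p j \<le> p i}"
proof -
  have "p i \<in> {1..n}" using permutes_in_image[OF p] i by blast
  then have "{1..p i} = {x \<in> p ` {1..n}. x \<le> p i}"
    unfolding permutes_image[OF p] by auto
  also have "\<dots> = p ` {j \<in> {1..n}. p j \<le> p i}" by blast
  finally have "{1..p i} = p ` {j \<in> {1..n}. p j \<le> p i}" .
  moreover have "inj_on p {j \<in> {1..n}. p j \<le> p i}"
    using permutes_inj[OF p] by (auto simp: inj_on_def inj_def)
  ultimately have "card {1..p i} = card {j \<in> {1..n}. p j \<le> p i}"
    by (metis card_image)
  then show ?thesis by simp
qed

lemma std_ex1:
  fixes u :: "'a::linorder list"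
  shows "\<exists>!p. p permutes {1..length u} \<and> inversions (perm_word (length u) p) = inversions u"
proof -
  define n where "n = length u"
  define le where "le j i \<longleftrightarrow> u ! (j - 1) < u ! (i - 1) \<or> (u ! (j - 1) = u ! (i - 1) \<and> j \<le> i)"
    for j i
  have le_trans: "le a b \<Longrightarrow> le b c \<Longrightarrow> le a c" for a b c unfolding le_def by auto
  have le_total: "le a b \<or> le b a" for a b unfolding le_def by auto
  have le_antisym: "le a b \<Longrightarrow> le b a \<Longrightarrow> a = b" for a b unfolding le_def by auto
  define S where "S i = {j \<in> {1..n}. le j i}" for i
  define p where "p i = (if i \<in> {1..n} then card (S i) else i)" for i
  have finS: "finite (S i)" for i unfolding S_def by simp
  have self: "i \<in> {1..n} \<Longrightarrow> i \<in> S i" for i unfolding S_def le_def by simp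
  have less: "p i < p j" if "i \<in> {1..n}" "j \<in> {1..n}" "le i j" "i \<noteq> j" for i j
  proof -
    have "S i \<subseteq> S j" using le_trans that unfolding S_def by blast
    moreover have "j \<in> S j" "j \<notin> S i" using self that le_antisym unfolding S_def by blast+
    ultimately have "S i \<subset> S j" by blast
    then have "card (S i) < card (S j)" by (rule psubset_card_mono[OF finS])
    then show ?thesis using that unfolding p_def by simp
  qed
  have inj: "inj_on p {1..n}"
    by (rule inj_onI) (metis le_total less less_irrefl)
  have "p i \<in> {1..n}" if i: "i \<in> {1..n}" for i
  proof -
    have "card (S i) \<le> card {1..n}" by (rule card_mono) (auto simp: S_def)
    moreover have "card (S i) \<noteq> 0" using self[OF i] finS by auto
    ultimately show ?thesis using i by (auto simp: p_def)
  qed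
  then have "p ` {1..n} = {1..n}"
    by (intro endo_inj_surj inj) auto
  then have perm: "p permutes {1..n}"
    using inj by (intro bij_imp_permutes) (auto simp: bij_betw_def p_def)
  have "p j < p i \<longleftrightarrow> u ! (j - 1) < u ! (i - 1)" if "1 \<le> i" "i < j" "j \<le> n" for i j
  proof -
    have "p j < p i \<longleftrightarrow> le j i"
      using less[of i j] less[of j i] le_total[of i j] that by fastforce
    also have "\<dots> \<longleftrightarrow> u ! (j - 1) < u ! (i - 1)" using that by (auto simp: le_def)
    finally show ?thesis .
  qed
  then have "inversions (perm_word n p) = inversions u"
    by (auto simp: inversions_perm_word inversions_def[of u] n_def)
  moreover have "q = r"
    if q: "q permutes {1..n}" and r: "r permutes {1..n}"
      and inv: "inversions (perm_word n q) = inversions (perm_word n r)" for q r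
  proof
    fix i show "q i = r i"
    proof (cases "i \<in> {1..n}")
      case i: True
      have gt: "q b < q a \<longleftrightarrow> r b < r a" if "1 \<le> a" "a < b" "b \<le> n" for a b
        using inv that by (auto simp: inversions_perm_word set_eq_iff)
      have "q j \<le> q i \<longleftrightarrow> r j \<le> r i" if j: "j \<in> {1..n}" for j
      proof (cases j i rule: linorder_cases)
        case less
        then show ?thesis using gt[of j i] i j by (auto simp: not_less[symmetric])
      next
        case greater
        then have "q j \<noteq> q i" "r j \<noteq> r i"
          using permutes_inj[OF q] permutes_inj[OF r] by (auto simp: inj_eq)
        then show ?thesis using gt[of i j] greater i j by (auto simp: order_le_less)
      qed simp
      then have "{j \<in> {1..n}. q j \<le> q i} = {j \<in> {1..n}. r j \<le> r i}" by blast
      then show ?thesis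
        using permutes_rank[OF q i] permutes_rank[OF r i] by simp
    next
      case False
      then show ?thesis using q r by (simp add: permutes_not_in)
    qed
  qed
  ultimately show ?thesis using perm unfolding n_def by metis
qed

text \<open>
  For \<open>a = Min (set u)\<close>, splitting \<open>u\<close> at its first letter \<open>a\<close> gives the factorisation \<open>u = v a w\<close>
  with \<open>a < min(v)\<close>; for \<open>b = Max (set u)\<close>, splitting at its last letter \<open>b\<close> gives \<open>u = v b w\<close>
  with \<open>b > max(w)\<close>. The factorisations themselves are in \<open>incr_split\<close> and \<open>decr_split\<close> below.
\<close>

function incr :: "'a::linorder list \<Rightarrow> 'a tree" where
  "incr u = (if u = [] then \<langle>\<rangle> else
     (let a = Min (set u);
          v = takeWhile (\<lambda>x. x \<noteq> a) u;
          w = tl (dropWhile (\<lambda>x. x \<noteq> a) u)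
      in \<langle>incr v, a, incr w\<rangle>))"
  by pat_completeness auto
termination
proof (relation "measure length", goal_cases)
  case 1
  show ?case by simp
next
  case (2 u a v w)
  then have "a \<in> set u" by simp
  then have "length v \<noteq> length u"
    by (metis (mono_tags, lifting) 2(3) length_takeWhile_le set_takeWhileD takeWhile_eq_take take_all_iff
        order_refl)
  then show ?case using 2(3) length_takeWhile_le[of "\<lambda>x. x \<noteq> a" u] by simp
next
  case (3 u a v w)
  then show ?case using length_dropWhile_le[of "\<lambda>x. x \<noteq> a" u] by (cases u) auto
qed

function decr :: "'a::linorder list \<Rightarrow> 'a tree" where
  "decr u = (if u = [] then \<langle>\<rangle> else
     (let b = Max (set u);
          v = rev (tl (dropWhile (\<lambda>x. x \<noteq> b) (rev u)));
          w = rev (takeWhile (\<lambda>x. x \<noteq> b) (rev u))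
      in \<langle>decr v, b, decr w\<rangle>))"
  by pat_completeness auto
termination
proof (relation "measure length", goal_cases)
  case 1
  show ?case by simp
next
  case (2 u b v w)
  then show ?case using length_dropWhile_le[of "\<lambda>x. x \<noteq> b" "rev u"] by (cases u) auto
next
  case (3 u b v w)
  then have "b \<in> set (rev u)" by simp
  then have "length w \<noteq> length (rev u)"
    by (metis (mono_tags, lifting) 3(4) length_rev length_takeWhile_le set_takeWhileD takeWhile_eq_take
        take_all_iff order_refl)
  then show ?case using 3(4) length_takeWhile_le[of "\<lambda>x. x \<noteq> b" "rev u"] by simp
qed

declare incr.simps [simp del] decr.simps [simp del]

lemma incr_split:
  assumes "a = Min (set (v @ a # w))" "\<forall>x\<in>set v. a < x"
  shows "incr (v @ a # w) = \<langle>incr v, a, incr w\<rangle>"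
proof -
  have "takeWhile (\<lambda>x. x \<noteq> a) (v @ a # w) = v" "dropWhile (\<lambda>x. x \<noteq> a) (v @ a # w) = a # w"
    using assms(2) by (subst takeWhile_append2 dropWhile_append2; auto)+
  then show ?thesis
    by (subst incr.simps) (simp only: assms(1)[symmetric] Let_def, simp)
qed

lemma decr_split:
  assumes "b = Max (set (v @ b # w))" "\<forall>x\<in>set w. b > x"
  shows "decr (v @ b # w) = \<langle>decr v, b, decr w\<rangle>"
proof -
  have r: "rev (v @ b # w) = rev w @ b # rev v" by simp
  have "takeWhile (\<lambda>x. x \<noteq> b) (rev (v @ b # w)) = rev w"
    "dropWhile (\<lambda>x. x \<noteq> b) (rev (v @ b # w)) = b # rev v"
    unfolding r using assms(2) by (subst takeWhile_append2 dropWhile_append2; auto)+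
  then show ?thesis
    by (subst decr.simps) (simp only: assms(1)[symmetric] Let_def, simp)
qed

definition Q_symbol :: "'a::linorder list \<Rightarrow> nat tree \<times> nat tree" where
  "Q_symbol u = (let \<sigma> = perm_word (length u) (inv (std u)) in (incr \<sigma>, decr \<sigma>))"

end

theory Submission
  imports Defs
begin

text \<open>
  Let \<open>\<sigma>\<close> be the word of \<open>std(u)\<^sup>-\<^sup>1\<close>. It lists the positions of \<open>u\<close> sorted stably by the letters they
  carry. The first letter of \<open>u\<close> is the root of \<open>T\<^sub>L\<close>, and it splits \<open>\<sigma>\<close> exactly where \<open>incr\<close> does;
  hence \<open>P(u)\<close> is \<open>Q(u)\<close> with each position replaced by its letter, and the shapes agree. In a tree
  whose labels are ordered along its branches, the leaf between two consecutive nodes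
  (in inorder) tells which of them is the ancestor, so the canopies of \<open>incr(\<sigma>)\<close> and \<open>decr(\<sigma>)\<close> read
  the ascents and the descents of \<open>\<sigma>\<close> and are complementary. Conversely the common inorder readings
  \<open>w\<close> of \<open>T\<^sub>L, T\<^sub>R\<close> and \<open>\<sigma>\<close> of \<open>S\<^sub>L, S\<^sub>R\<close> determine the word, the letter at position \<open>\<sigma>\<^sub>k\<close> being \<open>w\<^sub>k\<close>.
  The word so defined has the right symbols since the pairs \<open>(w\<^sub>k, \<sigma>\<^sub>k)\<close> increase lexicographically.
\<close>

section \<open>Trees ordered along branches\<close>

lemma parent_child_root:
  assumes "transp R" "parent_child R t" "t = \<langle>l, a, r\<rangle>" "x \<in> set_tree l \<union> set_tree r"
  shows "R a x"
  using assms(2-)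
proof (induction t arbitrary: l a r x)
  case (Node l' a' r')
  have sub: "R a' x" if t: "t = l' \<or> t = r'" and x: "x \<in> set_tree t" for t
  proof (cases t)
    case (Node l1 b r1)
    have ab: "R a' b" using Node.prems(1) t Node by auto
    have "x = b \<or> R b x"
      using t x Node Node.IH(1)[of l1 b r1 x] Node.IH(2)[of l1 b r1 x] Node.prems(1) by auto
    then show ?thesis using ab assms(1) by (auto dest: transpD)
  qed (use x in simp)
  then show ?case using Node.prems by auto
qed simp

text \<open>Transitivity carries the condition from the children down to all descendants. In this
  form it yields the bounds that \<open>incr_split'\<close> and \<open>decr_split'\<close> ask
  for.\<close>

lemma parent_child_Node_iff:
  assumes "transp R"
  shows "parent_child R \<langle>l, a, r\<rangle> \<longleftrightarrow>
    (\<forall>x \<in> set_tree l \<union> set_tree r. R a x) \<and> parent_child R l \<and> parent_child R r"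
proof
  assume "parent_child R \<langle>l, a, r\<rangle>"
  then show "(\<forall>x \<in> set_tree l \<union> set_tree r. R a x) \<and> parent_child R l \<and> parent_child R r"
    using parent_child_root[OF assms _ refl] by (metis parent_child.simps(2))
qed (cases l; cases r; simp)

lemmas parent_child_less_Node_iff = parent_child_Node_iff[OF transp_on_less]
lemmas parent_child_greater_Node_iff = parent_child_Node_iff[OF transp_on_greater]

section \<open>Canopies as words of ascents or descents\<close>

fun steps :: "('a \<Rightarrow> 'a \<Rightarrow> bool) \<Rightarrow> 'a list \<Rightarrow> nat list" where
  "steps R (x # y # zs) = (if R x y then 1 else 0) # steps R (y # zs)"
| "steps R _ = []"

lemma steps_append: "steps R (xs @ y # zs) = steps R (xs @ [y]) @ steps R (y # zs)"
  by (induction R xs rule: steps.induct) auto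

lemma steps_Cons: "ys \<noteq> [] \<Longrightarrow> R a (hd ys) \<Longrightarrow> steps R (a # ys) = 1 # steps R ys"
  by (cases ys) auto

lemma steps_snoc: "xs \<noteq> [] \<Longrightarrow> \<not> R (last xs) a \<Longrightarrow> steps R (xs @ [a]) = steps R xs @ [0]"
  by (induction R xs rule: steps.induct) auto

lemma nth_steps:
  "Suc i < length xs \<Longrightarrow> steps R xs ! i = (if R (xs ! i) (xs ! Suc i) then 1 else 0)"
  by (induction R xs arbitrary: i rule: steps.induct) (auto simp: nth_Cons split: nat.splits)

text \<open>Of two nodes consecutive in inorder one is an ancestor of the other. If it is the first,
  the leaf between them is the left child of the second; otherwise it is the right child of the
  first. The outer 1 and 0 belong to the extreme leaves, which the canopy drops.\<close>

lemma leaf_sides_steps: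
  assumes "transp R" "asymp R" "parent_child R t" "t \<noteq> \<langle>\<rangle>"
  shows "leaf_sides d t = 1 # steps R (inorder t) @ [0]"
  using assms(3-)
proof (induction t arbitrary: d)
  case (Node l a r)
  note pc = Node.prems(1)[unfolded parent_child_Node_iff[OF assms(1)]]
  \<comment> \<open>If \<open>l\<close> is empty, its leaf is the left child of \<open>a\<close> and
    the default 1 is the leading entry. Otherwise the last leaf of \<open>l\<close> lies just before
    \<open>a\<close> and contributes the 0 of a non-step.\<close>
  have l: "leaf_sides 1 l = 1 # steps R (inorder l @ [a])"
  proof (cases "l = \<langle>\<rangle>")
    case False
    then have "last (inorder l) \<in> set_tree l"
      by (metis eq_inorder_Nil last_in_set set_inorder)
    then have "\<not> R (last (inorder l)) a" using pc asympD[OF assms(2)] by auto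
    then show ?thesis using False pc Node.IH(1) by (simp add: steps_snoc)
  qed simp
  have r: "leaf_sides 0 r = steps R (a # inorder r) @ [0]"
  proof (cases "r = \<langle>\<rangle>")
    case False
    then have "hd (inorder r) \<in> set_tree r"
      by (metis eq_inorder_Nil list.set_sel(1) set_inorder)
    then have "R a (hd (inorder r))" using pc by auto
    then show ?thesis using False pc Node.IH(2) by (simp add: steps_Cons)
  qed simp
  show ?case using steps_append[of R "inorder l" a "inorder r"] by (simp add: l r del: One_nat_def)
qed simp

lemma canopy_parent_child:
  assumes "transp R" "asymp R" "parent_child R t"
  shows "canopy t = steps R (inorder t)"
  using leaf_sides_steps[OF assms, of 0] by (cases "t = \<langle>\<rangle>") (auto simp: canopy_def butlast_append)

lemma shape_map_tree: "shape (map_tree f t) = shape t"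
  by (simp add: shape_def tree.map_comp comp_def)

lemma canopy_shape: "canopy (shape t) = canopy t"
proof -
  have "leaf_sides d (map_tree f t) = leaf_sides d t" for d and f :: "'a \<Rightarrow> unit"
    by (induction t arbitrary: d) auto
  then show ?thesis by (simp add: canopy_def shape_def)
qed

text \<open>Carries the twin property from the trees of positions over to the search trees.\<close>

lemma twin_binary_trees_cong_shape:
  assumes "shape tL = shape sL" "shape tR = shape sR"
  shows "twin_binary_trees (tL, tR) \<longleftrightarrow> twin_binary_trees (sL, sR)"
proof -
  have "size tL = size sL" "size tR = size sR"
    using assms by (metis shape_def size_map_tree)+
  moreover have "canopy tL = canopy sL" "canopy tR = canopy sR"
    using assms by (metis canopy_shape)+
  ultimately show ?thesis by (simp add: twin_binary_trees_def)
qed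

lemma twin_binary_trees_incr_decr:
  fixes sL sR :: "'a::linorder tree"
  assumes "parent_child (\<lambda>p c. c > p) sL" "parent_child (\<lambda>p c. c < p) sR"
    and "inorder sL = inorder sR" "distinct (inorder sL)"
  shows "twin_binary_trees (sL, sR)"
proof -
  have size: "size sL = size sR" by (metis assms(3) length_inorder)
  have "canopy sL ! i \<noteq> canopy sR ! i" if i: "i < size sL - 1" for i
  proof -
    have L: "canopy sL = steps (\<lambda>p c. c > p) (inorder sL)"
      using assms(1) by (intro canopy_parent_child) (auto simp: transp_def asymp_on_def)
    have R: "canopy sR = steps (\<lambda>p c. c < p) (inorder sL)"
      unfolding assms(3) using assms(2) by (intro canopy_parent_child) (auto simp: transp_def asymp_on_def)
    \<comment> \<open>Without equal neighbours, each step is exactly one of ascent and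
      descent.\<close>
    have "inorder sL ! i \<noteq> inorder sL ! Suc i"
      using i assms(4) by (simp add: nth_eq_iff_index_eq)
    then show ?thesis using i by (auto simp: L R nth_steps)
  qed
  then show ?thesis using size by (simp add: twin_binary_trees_def)
qed

text \<open>The size of the left subtree fixes where the root sits in the inorder reading.\<close>

lemma tree_eqI_shape_inorder:
  "shape s = shape t \<Longrightarrow> inorder s = inorder t \<Longrightarrow> s = t"
proof (induction s arbitrary: t)
  case (Node l a r)
  then obtain l' a' r' where t: "t = \<langle>l', a', r'\<rangle>" by (cases t) (auto simp: shape_def)
  then have sh: "shape l = shape l'" "shape r = shape r'" using Node.prems by (auto simp: shape_def)
  then have "length (inorder l) = length (inorder l')" by (metis shape_def size_map_tree length_inorder)
  then show ?case using Node t sh by simp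
qed (auto simp: shape_def)

section \<open>Increasing and decreasing trees of a word\<close>

lemma incr_Nil [simp]: "incr [] = \<langle>\<rangle>" and decr_Nil [simp]: "decr [] = \<langle>\<rangle>"
  by (simp_all add: incr.simps decr.simps)

lemma incr_split':
  assumes "\<forall>x\<in>set v. a < x" "\<forall>x\<in>set w. a \<le> x"
  shows "incr (v @ a # w) = \<langle>incr v, a, incr w\<rangle>"
  using assms by (intro incr_split Min_eqI[symmetric]) (auto simp: less_imp_le)

lemma decr_split':
  assumes "\<forall>x\<in>set w. x < b" "\<forall>x\<in>set v. x \<le> b"
  shows "decr (v @ b # w) = \<langle>decr v, b, decr w\<rangle>"
  using assms by (intro decr_split Max_eqI[symmetric]) (auto simp: less_imp_le)

text \<open>The root is strictly below all other labels, so \<open>incr\<close> splits the reading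
  exactly there.\<close>

lemma incr_inorder:
  "parent_child (\<lambda>p c. c > p) t \<Longrightarrow> incr (inorder t) = t"
proof (induction t)
  case (Node l a r)
  note pc = Node.prems[unfolded parent_child_less_Node_iff]
  have "incr (inorder l @ a # inorder r) = \<langle>incr (inorder l), a, incr (inorder r)\<rangle>"
    using pc by (intro incr_split') (auto simp: less_imp_le)
  then show ?case using Node.IH pc by simp
qed simp

lemma decr_inorder:
  "parent_child (\<lambda>p c. c < p) t \<Longrightarrow> decr (inorder t) = t"
proof (induction t)
  case (Node l a r)
  note pc = Node.prems[unfolded parent_child_greater_Node_iff]
  have "decr (inorder l @ a # inorder r) = \<langle>decr (inorder l), a, decr (inorder r)\<rangle>"
    using pc by (intro decr_split') (auto simp: less_imp_le)
  then show ?case using Node.IH pc by simp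
qed simp

text \<open>Distinct letters make the minimum strict on both sides, as the order along branches
  demands. With \<open>incr_inorder\<close>, \<open>incr\<close> and \<open>inorder\<close> are
  mutually inverse on words with distinct letters.\<close>

lemma incr_distinct:
  "distinct u \<Longrightarrow> inorder (incr u) = u \<and> parent_child (\<lambda>p c. c > p) (incr u)"
proof (induction u rule: length_induct)
  case (1 u)
  show ?case
  proof (cases "u = []")
    case False
    define a where "a = Min (set u)"
    have "a \<in> set u" using False by (simp add: a_def)
    then obtain v w where u: "u = v @ a # w" by (meson split_list)
    have lt: "a < x" if "x \<in> set v \<union> set w" for x
    proof -
      have "x \<in> set u" using that by (auto simp: u)
      then have "a \<le> x" by (simp add: a_def)
      moreover have "x \<noteq> a" using that "1.prems" unfolding u by auto
      ultimately show ?thesis by simp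
    qed
    have "length v < length u" "length w < length u" "distinct v" "distinct w"
      using "1.prems" by (auto simp: u)
    then have IH: "inorder (incr v) = v" "parent_child (\<lambda>p c. c > p) (incr v)"
      "inorder (incr w) = w" "parent_child (\<lambda>p c. c > p) (incr w)"
      using "1.IH" by auto
    then have "set_tree (incr v) = set v" "set_tree (incr w) = set w"
      by (metis set_inorder)+
    moreover have "incr u = \<langle>incr v, a, incr w\<rangle>"
      unfolding u using lt by (intro incr_split') (auto simp: less_imp_le)
    ultimately show ?thesis
      using IH lt by (simp add: u parent_child_less_Node_iff del: parent_child.simps(2))
  qed simp
qed

lemma decr_distinct:
  "distinct u \<Longrightarrow> inorder (decr u) = u \<and> parent_child (\<lambda>p c. c < p) (decr u)"
proof (induction u rule: length_induct)
  case (1 u)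
  show ?case
  proof (cases "u = []")
    case False
    define a where "a = Max (set u)"
    have "a \<in> set u" using False by (simp add: a_def)
    then obtain v w where u: "u = v @ a # w" by (meson split_list)
    have lt: "x < a" if "x \<in> set v \<union> set w" for x
    proof -
      have "x \<in> set u" using that by (auto simp: u)
      then have "x \<le> a" by (simp add: a_def)
      moreover have "x \<noteq> a" using that "1.prems" unfolding u by auto
      ultimately show ?thesis by simp
    qed
    have "length v < length u" "length w < length u" "distinct v" "distinct w"
      using "1.prems" by (auto simp: u)
    then have IH: "inorder (decr v) = v" "parent_child (\<lambda>p c. c < p) (decr v)"
      "inorder (decr w) = w" "parent_child (\<lambda>p c. c < p) (decr w)"
      using "1.IH" by auto
    then have "set_tree (decr v) = set v" "set_tree (decr w) = set w"
      by (metis set_inorder)+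
    moreover have "decr u = \<langle>decr v, a, decr w\<rangle>"
      unfolding u using lt by (intro decr_split') (auto simp: less_imp_le)
    ultimately show ?thesis
      using IH lt by (simp add: u parent_child_greater_Node_iff del: parent_child.simps(2))
  qed simp
qed

section \<open>Binary search trees\<close>

lemma set_left_insert [simp]: "set_tree (left_insert a t) = insert a (set_tree t)"
  by (induction t) auto

lemma set_right_insert [simp]: "set_tree (right_insert a t) = insert a (set_tree t)"
  by (induction t) auto

lemma left_bst_left_insert: "left_bst t \<Longrightarrow> left_bst (left_insert a t)"
  by (induction t) auto

lemma right_bst_right_insert: "right_bst t \<Longrightarrow> right_bst (right_insert a t)"
  by (induction t) auto

lemma left_bst_fold: "left_bst t \<Longrightarrow> left_bst (fold left_insert u t)"
  by (induction u arbitrary: t) (auto simp: left_bst_left_insert)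

lemma right_bst_foldr: "right_bst t \<Longrightarrow> right_bst (foldr right_insert u t)"
  by (induction u) (auto simp: right_bst_right_insert)

text \<open>The root sends each letter to one side for good, so the two subtrees grow independently
  from the two subwords.\<close>

lemma fold_left_insert_Node:
  "fold left_insert u \<langle>l, b, r\<rangle> =
    \<langle>fold left_insert (filter (\<lambda>x. x < b) u) l, b, fold left_insert (filter (\<lambda>x. \<not> x < b) u) r\<rangle>"
  by (induction u arbitrary: l r) auto

lemma foldr_right_insert_Node:
  "foldr right_insert u \<langle>l, b, r\<rangle> =
    \<langle>foldr right_insert (filter (\<lambda>x. x \<le> b) u) l, b, foldr right_insert (filter (\<lambda>x. \<not> x \<le> b) u) r\<rangle>"
  by (induction u) auto

section \<open>Stable sorting\<close>

text \<open>The lexicographic order on the pairs \<open>(f i, i)\<close>, which is what stable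
  sorting of an increasing list produces.\<close>

definition key_less :: "('b::linorder \<Rightarrow> 'a::linorder) \<Rightarrow> 'b \<Rightarrow> 'b \<Rightarrow> bool" where
  "key_less f i j \<longleftrightarrow> f i < f j \<or> f i = f j \<and> i < j"

text \<open>A strict total order lists a finite set in only one way; this reduces equations between
  sorted lists to equations between their sets.\<close>

lemma sorted_wrt_key_less_unique:
  assumes "sorted_wrt (key_less f) xs" "sorted_wrt (key_less f) ys" "set xs = set ys"
  shows "xs = ys"
  using assms
proof (induction xs arbitrary: ys)
  case (Cons x xs)
  have "ys \<noteq> []" using Cons.prems(3) by auto
  then obtain y ys' where ys: "ys = y # ys'" by (meson neq_Nil_conv)
  have "x = y"
  proof (rule ccontr)
    assume "x \<noteq> y"
    then have "x \<in> set ys'" "y \<in> set xs" using Cons.prems(3) by (auto simp: ys)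
    then have "key_less f y x" "key_less f x y" using Cons.prems by (auto simp: ys)
    then show False by (auto simp: key_less_def)
  qed
  moreover have "x \<notin> set xs" "y \<notin> set ys'" using Cons.prems ys by (auto simp: key_less_def)
  ultimately have "set xs = set ys'" using Cons.prems(3) ys by (metis insert_ident list.set(2))
  then show ?case using Cons.IH[of ys'] Cons.prems \<open>x = y\<close> ys by simp
qed simp

text \<open>\<open>sort_key\<close> inserts from the right, so each new element is smaller than
  those already placed, and \<open>insort_key\<close> puts it before those with the same
  key.\<close>

lemma sorted_wrt_key_less_sort_key:
  "sorted_wrt (<) ps \<Longrightarrow> sorted_wrt (key_less f) (sort_key f ps)"
proof (induction ps)
  case (Cons p ps)
  have "sorted_wrt (key_less f) (insort_key f p qs)"
    if "sorted_wrt (key_less f) qs" "\<forall>q\<in>set qs. p < q" for qs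
    using that by (induction qs) (auto simp: key_less_def set_insort_key)
  then show ?case using Cons by simp
qed simp

text \<open>The first position precedes all others with the same key, so ties go to the right, as
  they do in \<open>left_insert\<close>. In \<open>sort_key_last\<close> they go to the left, as in
  \<open>right_insert\<close>.\<close>

lemma sort_key_first:
  fixes f :: "'b::linorder \<Rightarrow> 'a::linorder"
  assumes "sorted_wrt (<) (p # ps)"
  shows "sort_key f (p # ps) =
    sort_key f (filter (\<lambda>q. f q < f p) ps) @ p # sort_key f (filter (\<lambda>q. \<not> f q < f p) ps)"
  using assms
  by (intro sorted_wrt_key_less_unique[of f] sorted_wrt_key_less_sort_key)
    (auto simp: sorted_wrt_append sorted_wrt_key_less_sort_key sorted_wrt_filter key_less_def
      simp del: sort_key_simps)

lemma sort_key_last: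
  fixes f :: "'b::linorder \<Rightarrow> 'a::linorder"
  assumes "sorted_wrt (<) (ps @ [p])"
  shows "sort_key f (ps @ [p]) =
    sort_key f (filter (\<lambda>q. f q \<le> f p) ps) @ p # sort_key f (filter (\<lambda>q. \<not> f q \<le> f p) ps)"
  using assms
  by (intro sorted_wrt_key_less_unique[of f] sorted_wrt_key_less_sort_key)
    (auto simp: sorted_wrt_append sorted_wrt_key_less_sort_key sorted_wrt_filter key_less_def
      simp del: sort_key_simps)

text \<open>The first position \<open>p\<close> is the least, so \<open>incr\<close> splits the
  sorted list at \<open>p\<close>, with the same two filtered lists as the insertion. Arbitrary
  increasing lists are needed because the recursion passes to subsequences.\<close>

lemma fold_left_insert_incr:
  "sorted_wrt (<) ps \<Longrightarrow>
    fold left_insert (map f ps) \<langle>\<rangle> = map_tree f (incr (sort_key f ps))"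
proof (induction ps rule: length_induct)
  case (1 ps)
  show ?case
  proof (cases ps)
    case (Cons p qs)
    have IH: "fold left_insert (map f (filter P qs)) \<langle>\<rangle> = map_tree f (incr (sort_key f (filter P qs)))" for P
      using 1 Cons by (simp add: le_imp_less_Suc sorted_wrt_filter)
    have "incr (sort_key f ps) = \<langle>incr (sort_key f (filter (\<lambda>q. f q < f p) qs)), p,
        incr (sort_key f (filter (\<lambda>q. \<not> f q < f p) qs))\<rangle>"
      unfolding Cons sort_key_first[OF "1.prems"[unfolded Cons]]
      using 1 Cons by (intro incr_split') (auto simp: less_imp_le)
    then show ?thesis
      using IH by (simp add: Cons fold_left_insert_Node filter_map comp_def del: not_less)
  qed simp
qed

lemma foldr_right_insert_decr:
  "sorted_wrt (<) ps \<Longrightarrow>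
    foldr right_insert (map f ps) \<langle>\<rangle> = map_tree f (decr (sort_key f ps))"
proof (induction ps rule: length_induct)
  case (1 ps)
  show ?case
  proof (cases ps rule: rev_cases)
    case (snoc qs p)
    have IH: "foldr right_insert (map f (filter P qs)) \<langle>\<rangle> = map_tree f (decr (sort_key f (filter P qs)))" for P
      using 1 snoc by (simp add: le_imp_less_Suc sorted_wrt_filter sorted_wrt_append)
    have "decr (sort_key f ps) = \<langle>decr (sort_key f (filter (\<lambda>q. f q \<le> f p) qs)), p,
        decr (sort_key f (filter (\<lambda>q. \<not> f q \<le> f p) qs))\<rangle>"
      unfolding snoc sort_key_last[OF "1.prems"[unfolded snoc]]
      using 1 snoc by (intro decr_split') (auto simp: less_imp_le sorted_wrt_append)
    then show ?thesis
      using IH by (simp add: snoc foldr_right_insert_Node filter_map comp_def del: not_le)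
  qed simp
qed

section \<open>Symbols of a word\<close>

definition letter_at :: "'a list \<Rightarrow> nat \<Rightarrow> 'a" where
  "letter_at u i = u ! (i - 1)"

definition sorted_positions :: "'a::linorder list \<Rightarrow> nat list" where
  "sorted_positions u = sort_key (letter_at u) [1..<Suc (length u)]"

lemma map_letter_at: "map (letter_at u) [1..<Suc (length u)] = u"
  by (rule nth_equalityI) (auto simp: letter_at_def simp del: upt_Suc)

lemma set_sorted_positions [simp]: "set (sorted_positions u) = {1..length u}"
  by (auto simp: sorted_positions_def)

lemma distinct_sorted_positions [simp]: "distinct (sorted_positions u)"
  by (simp add: sorted_positions_def del: upt_Suc)

lemma length_sorted_positions [simp]: "length (sorted_positions u) = length u"
  by (simp add: sorted_positions_def del: upt_Suc)

lemma sorted_wrt_positions: "sorted_wrt (key_less (letter_at u)) (sorted_positions u)"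
  unfolding sorted_positions_def by (intro sorted_wrt_key_less_sort_key sorted_wrt_upt)

text \<open>\<open>std u\<close> maps a position to its rank, so its inverse lists the positions by
  rank; equal inversions force the ranks to follow \<open>key_less\<close>.\<close>

lemma perm_word_inv_std:
  "perm_word (length u) (inv (std u)) = sorted_positions u"
proof (rule sorted_wrt_key_less_unique[OF _ sorted_wrt_positions])
  define n where "n = length u"
  define p where "p = std u"
  have "p permutes {1..n} \<and> inversions (perm_word n p) = inversions u"
    unfolding p_def n_def std_def by (rule theI'[OF std_ex1])
  then have p: "p permutes {1..n}" and inv: "inversions (perm_word n p) = inversions u" by auto
  have less: "letter_at u j < letter_at u i \<longleftrightarrow> p j < p i" if "1 \<le> i" "i < j" "j \<le> n" for i j
    using inv that by (auto simp: inversions_perm_word inversions_def[of u] letter_at_def n_def set_eq_iff)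
  have "key_less (letter_at u) (inv p k) (inv p l)" if "k \<in> {1..n}" "l \<in> {1..n}" "k < l" for k l
  proof -
    define i where "i = inv p k"
    define j where "j = inv p l"
    have ij: "p i = k" "p j = l" "i \<in> {1..n}" "j \<in> {1..n}"
      using p that permutes_in_image[OF permutes_inv[OF p]]
      by (auto simp: i_def j_def permutes_inverses simp del: atLeastAtMost_iff)
    \<comment> \<open>Here \<open>p i < p j\<close>. If \<open>i < j\<close>, there is no inversion
      and the letter at \<open>i\<close> is at most that at \<open>j\<close>; if
      \<open>j < i\<close>, there is one and it is strictly smaller.\<close>
    have "i \<noteq> j" using ij that by auto
    then have "key_less (letter_at u) i j"
      using less[of i j] less[of j i] ij that by (auto simp: key_less_def neq_iff)
    then show ?thesis by (simp add: i_def j_def)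
  qed
  then show "sorted_wrt (key_less (letter_at u)) (perm_word (length u) (inv (std u)))"
    by (auto simp: perm_word_def n_def p_def sorted_wrt_iff_nth_less simp del: upt_Suc)
  have "inv p ` {1..n} = {1..n}" using permutes_image[OF permutes_inv[OF p]] .
  then show "set (perm_word (length u) (inv (std u))) = set (sorted_positions u)"
    by (simp add: perm_word_def n_def p_def atLeastLessThanSuc_atLeastAtMost del: upt_Suc)
qed

lemma Q_symbol_eq: "Q_symbol u = (incr (sorted_positions u), decr (sorted_positions u))"
  by (simp add: Q_symbol_def perm_word_inv_std Let_def)

lemma P_symbol_eq:
  "P_symbol u = map_prod (map_tree (letter_at u)) (map_tree (letter_at u)) (Q_symbol u)"
  using fold_left_insert_incr[of "[1..<Suc (length u)]" "letter_at u"]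
    foldr_right_insert_decr[of "[1..<Suc (length u)]" "letter_at u"]
  unfolding map_letter_at Q_symbol_eq P_symbol_def sorted_positions_def[symmetric] by (simp del: upt_Suc)

section \<open>Injectivity and surjectivity\<close>

lemma symbols_inj:
  assumes "P_symbol u = P_symbol v" "Q_symbol u = Q_symbol v"
  shows "u = v"
proof -
  have inc: "inorder (incr (sorted_positions w)) = sorted_positions w" for w :: "'a list"
    using incr_distinct distinct_sorted_positions by blast
  have \<sigma>: "sorted_positions u = sorted_positions v" using assms(2) inc by (metis Q_symbol_eq prod.inject)
  then have n: "length u = length v" by (metis length_sorted_positions)
  have "map (letter_at u) (sorted_positions u) = map (letter_at v) (sorted_positions v)"
    using assms(1) inc unfolding P_symbol_eq Q_symbol_eq by (metis fst_conv inorder_map map_prod_simp)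
  \<comment> \<open>Every position occurs in \<open>sorted_positions u\<close>, so agreement along
    it is agreement everywhere.\<close>
  then have "\<forall>i\<in>{1..length u}. letter_at u i = letter_at v i"
    using \<sigma> n by (metis map_eq_conv set_sorted_positions)
  then have "map (letter_at u) [1..<Suc (length u)] = map (letter_at v) [1..<Suc (length v)]"
    by (auto simp: n)
  then show ?thesis unfolding map_letter_at .
qed

lemma bijectively_labeledI:
  "inorder t = sorted_positions u \<Longrightarrow> bijectively_labeled t"
  by (metis bijectively_labeled_def distinct_sorted_positions length_inorder length_sorted_positions
      set_inorder set_sorted_positions)

text \<open>Letters left of the root are strictly smaller. A letter on the right may equal that of
  the root, but then its label in the increasing tree is larger.\<close>

lemma zip_inorder_sorted:
  fixes t :: "'a::linorder tree" and s :: "nat tree"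
  assumes "shape t = shape s" "left_bst t" "parent_child (\<lambda>p c. c > p) s"
  shows "sorted_wrt (\<lambda>(x, i) (y, j). x < y \<or> x = y \<and> i < j) (zip (inorder t) (inorder s))"
  using assms
proof (induction t arbitrary: s)
  case (Node l a r)
  then obtain l' i r' where s: "s = \<langle>l', i, r'\<rangle>" by (cases s) (auto simp: shape_def)
  have sh: "shape l = shape l'" "shape r = shape r'" using Node.prems s by (auto simp: shape_def)
  then have len: "length (inorder l) = length (inorder l')"
    by (metis shape_def size_map_tree length_inorder)
  have pc: "\<forall>x\<in>set_tree r'. i < x" "parent_child (\<lambda>p c. c > p) l'" "parent_child (\<lambda>p c. c > p) r'"
    using Node.prems(3) unfolding s
    by (auto simp: parent_child_less_Node_iff simp del: parent_child.simps(2))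
  have L: "x < a" if "(x, j) \<in> set (zip (inorder l) (inorder l'))" for x j
    using that Node.prems(2) by (auto dest!: set_zip_leftD)
  have R: "a \<le> x \<and> i < j" if "(x, j) \<in> set (zip (inorder r) (inorder r'))" for x j
    using that Node.prems(2) pc by (auto dest: set_zip_leftD set_zip_rightD)
  \<comment> \<open>Labels in the two subtrees are not comparable in general, so the letters must
    decide, strictly, through the root letter \<open>a\<close>.\<close>
  have LR: "x < y" if "(x, j) \<in> set (zip (inorder l) (inorder l'))"
    "(y, k) \<in> set (zip (inorder r) (inorder r'))" for x y j k
    using L[OF that(1)] R[OF that(2)] by auto
  have "left_bst l" "left_bst r" using Node.prems(2) by auto
  note IH = Node.IH(1)[OF sh(1) this(1) pc(2)] Node.IH(2)[OF sh(2) this(2) pc(3)]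
  have zip: "zip (inorder \<langle>l, a, r\<rangle>) (inorder s) =
      zip (inorder l) (inorder l') @ (a, i) # zip (inorder r) (inorder r')"
    using len by (simp add: s)
  show ?case
    unfolding zip sorted_wrt_append list.set sorted_wrt.simps
    using IH L R LR by (auto simp: order_le_less)
qed simp

lemma symbols_surj:
  fixes tL tR :: "'a::linorder tree"
  assumes t: "left_bst tL" "inorder tL = inorder tR"
    and s: "increasing_tree sL" "decreasing_tree sR" "inorder sL = inorder sR"
    and sh: "shape tL = shape sL" "shape tR = shape sR"
  obtains u where "P_symbol u = (tL, tR)" "Q_symbol u = (sL, sR)"
proof -
  define n where "n = size sL"
  define \<sigma> where "\<sigma> = inorder sL"
  define w where "w = inorder tL"
  have \<sigma>: "distinct \<sigma>" "set \<sigma> = {1..n}" "length \<sigma> = n"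
    using s(1) by (auto simp: increasing_tree_def bijectively_labeled_def \<sigma>_def n_def)
  have len: "length w = length \<sigma>"
    unfolding w_def \<sigma>_def using sh(1) by (metis shape_def size_map_tree length_inorder)
  \<comment> \<open>Sends the k-th letter of \<open>\<sigma>\<close> to that of \<open>w\<close>; as
    \<open>\<sigma>\<close> lists \<open>{1..n}\<close> without repetition, \<open>f\<close> is
    determined on all positions.\<close>
  define f where "f = the \<circ> map_of (zip \<sigma> w)"
  have w: "map f \<sigma> = w"
    using \<sigma>(1) len by (intro nth_equalityI) (auto simp: f_def map_of_zip_nth)
  define u where "u = map f [1..<Suc n]"
  have f: "letter_at u i = f i" if "i \<in> {1..n}" for i
    using that by (auto simp: letter_at_def u_def simp del: upt_Suc)
  have w': "map (letter_at u) \<sigma> = w" unfolding w[symmetric] by (intro map_cong) (auto simp: \<sigma>(2) f)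
  have "sorted_wrt (\<lambda>(x, i) (y, j). x < y \<or> x = y \<and> i < j) (zip w \<sigma>)"
    unfolding w_def \<sigma>_def using sh(1) t(1) s(1) by (intro zip_inorder_sorted) (auto simp: increasing_tree_def)
  then have "sorted_wrt (key_less (letter_at u)) \<sigma>"
    unfolding w'[symmetric] by (simp add: sorted_wrt_iff_nth_less key_less_def)
  moreover have "set \<sigma> = set (sorted_positions u)" by (simp add: \<sigma>(2) u_def del: upt_Suc)
  \<comment> \<open>By uniqueness of the sorted listing, the prescribed \<open>\<sigma>\<close> is
    the stable sort of the constructed word.\<close>
  ultimately have \<sigma>_eq: "sorted_positions u = \<sigma>"
    using sorted_wrt_key_less_unique sorted_wrt_positions by blast
  have Q: "Q_symbol u = (sL, sR)"
    using s incr_inorder[of sL] decr_inorder[of sR]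
    by (simp add: Q_symbol_eq \<sigma>_eq \<sigma>_def increasing_tree_def decreasing_tree_def)
  have tL: "map (letter_at u) (inorder sL) = inorder tL" using w' by (simp only: \<sigma>_def w_def)
  have "map_tree (letter_at u) sL = tL"
    by (rule tree_eqI_shape_inorder) (simp_all add: shape_map_tree inorder_map sh tL)
  moreover have "map_tree (letter_at u) sR = tR"
    by (rule tree_eqI_shape_inorder)
      (simp_all add: shape_map_tree inorder_map sh tL s(3)[symmetric] t(2)[symmetric])
  ultimately have "P_symbol u = (tL, tR)" by (simp add: P_symbol_eq Q)
  then show ?thesis using Q that by blast
qed

lemma symbols_twin:
  assumes "P_symbol u = (tL, tR)" "Q_symbol u = (sL, sR)"
  shows "twin_bsts (tL, tR)" "twin_binary_trees (sL, sR)" "increasing_tree sL" "decreasing_tree sR"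
    "inorder sL = inorder sR" "shape tL = shape sL" "shape tR = shape sR"
proof -
  have S: "sL = incr (sorted_positions u)" "sR = decr (sorted_positions u)"
    using assms(2) by (auto simp: Q_symbol_eq)
  have T: "tL = map_tree (letter_at u) sL" "tR = map_tree (letter_at u) sR"
    using assms by (auto simp: P_symbol_eq)
  have L: "inorder sL = sorted_positions u" "parent_child (\<lambda>p c. c > p) sL"
    unfolding S using incr_distinct[of "sorted_positions u"] by auto
  have R: "inorder sR = sorted_positions u" "parent_child (\<lambda>p c. c < p) sR"
    unfolding S using decr_distinct[of "sorted_positions u"] by auto
  show inc: "increasing_tree sL" "decreasing_tree sR"
    using L R bijectively_labeledI by (auto simp: increasing_tree_def decreasing_tree_def)
  show eq: "inorder sL = inorder sR" using L R by simp
  show twin: "twin_binary_trees (sL, sR)"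
    using L R eq by (intro twin_binary_trees_incr_decr) auto
  show sh: "shape tL = shape sL" "shape tR = shape sR" by (simp_all add: T shape_map_tree)
  have "left_bst tL" "right_bst tR"
    using assms(1) left_bst_fold[of "\<langle>\<rangle>" u] right_bst_foldr[of "\<langle>\<rangle>" u] by (auto simp: P_symbol_def)
  moreover have "inorder tL = inorder tR" by (simp add: T inorder_map eq)
  ultimately show "twin_bsts (tL, tR)"
    using twin twin_binary_trees_cong_shape[OF sh] by (simp add: twin_bsts_def)
qed

theorem theorem4p9:
  fixes letter :: "nat \<Rightarrow> 'a::linorder"
  assumes "strict_mono letter" and "range letter = UNIV"
  shows "bij_betw (\<lambda>u :: 'a list. (P_symbol u, Q_symbol u)) UNIV
    {((T\<^sub>L, T\<^sub>R), (S\<^sub>L, S\<^sub>R)).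
       twin_bsts (T\<^sub>L, T\<^sub>R) \<and>
       (twin_binary_trees (S\<^sub>L, S\<^sub>R) \<and> increasing_tree S\<^sub>L \<and> decreasing_tree S\<^sub>R \<and>
         inorder S\<^sub>L = inorder S\<^sub>R) \<and>
       (shape T\<^sub>L = shape S\<^sub>L \<and> shape T\<^sub>R = shape S\<^sub>R)}"
    (is "bij_betw ?F UNIV ?B")
proof (rule bij_betw_imageI)
  show "inj ?F" by (rule injI) (auto intro: symbols_inj)
  show "range ?F = ?B"
  proof
    show "range ?F \<subseteq> ?B"
    proof (rule image_subsetI)
      fix u :: "'a list"
      obtain tL tR sL sR where "P_symbol u = (tL, tR)" "Q_symbol u = (sL, sR)" by fastforce
      from symbols_twin[OF this] this show "?F u \<in> ?B" by simp
    qed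
    show "?B \<subseteq> range ?F"
    proof clarify
      fix tL tR :: "'a tree" and sL sR
      assume "twin_bsts (tL, tR)" "increasing_tree sL" "decreasing_tree sR" "inorder sL = inorder sR"
        "shape tL = shape sL" "shape tR = shape sR"
      then obtain u where "P_symbol u = (tL, tR)" "Q_symbol u = (sL, sR)"
        unfolding twin_bsts_def by (auto elim: symbols_surj[of tL tR sL sR])
      then have "((tL, tR), (sL, sR)) = ?F u" by simp
      then show "((tL, tR), (sL, sR)) \<in> range ?F" by (rule range_eqI)
    qed
  qed
qed

end
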